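(* Let $n\ge 1$, $a$, $k\ge 1$, $d\ge 1$ be integers, and let $K_{n,n}$ be the complete bipartite graph with both parts of size $n$. Suppose the equation $ax+(a+1)y=n$ has two solutions $(x_1,y_1)$ and $(x_2,y_2)$ in nonnegative integers (not necessarily different), and put $z_1=x_1+y_1$, $z_2=x_2+y_2$. Then $K_{n,n}$ has an equitable $(z_1+z_2,k,d)$-tree-coloring in which every color class has size either $a$ or $a+1$.
   Context: A $t$-coloring of a graph $G$ is a map $f:V(G)\to\{1,\dots,t\}$ (not necessarily surjective) with color classes $V_i=f^{-1}(i)$; it is equitable if $||V_i|-|V_j||\le 1$ for all $i,j$. It is a $(t,k,d)$-tree-coloring if for every $i$, each connected component of $G[V_i]$ is a tree of maximum degree at most $k$ and diameter at most $d$. *)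

theory Defs
  imports "Graph_Theory.Graph_Theory"
begin

text \<open>
  Finite simple graphs are the symmetric digraphs of the locale \<^locale>\<open>graph\<close>: an undirected
  edge is a pair of opposite arcs. The library's \<^const>\<open>forest\<close> and \<^const>\<open>tree\<close> are not usable for
  these, because going back and forth along one edge is a \<^const>\<open>pre_digraph.cycle\<close> of length 2. In a
  loop-free graph without parallel arcs, the undirected cycles are the cycles of length at least 3.
\<close>

definition undirected_forest :: "('a, 'b) pre_digraph \<Rightarrow> bool" where
  "undirected_forest G \<longleftrightarrow> \<not> (\<exists>p. pre_digraph.cycle G p \<and> 3 \<le> length p)"

definition undirected_tree :: "('a, 'b) pre_digraph \<Rightarrow> bool" where
  "undirected_tree G \<longleftrightarrow> connected G \<and> undirected_forest G"

text \<open>In a symmetric digraph the out-degree of a vertex is its degree in the undirected sense.\<close>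

definition max_degree :: "('a, 'b) pre_digraph \<Rightarrow> nat" where
  "max_degree G = Max (out_degree G ` verts G)"

definition diameter :: "('a, 'b) pre_digraph \<Rightarrow> ereal" where
  "diameter G = (SUP u\<in>verts G. SUP v\<in>verts G. wf_digraph.\<mu> G (\<lambda>_. 1) u v)"

definition color_class :: "('a, 'b) pre_digraph \<Rightarrow> ('a \<Rightarrow> nat) \<Rightarrow> nat \<Rightarrow> 'a set" where
  "color_class G f i = {v \<in> verts G. f v = i}"

definition coloring :: "('a, 'b) pre_digraph \<Rightarrow> nat \<Rightarrow> ('a \<Rightarrow> nat) \<Rightarrow> bool" where
  "coloring G t f \<longleftrightarrow> f ` verts G \<subseteq> {1..t}"

definition equitable :: "('a, 'b) pre_digraph \<Rightarrow> nat \<Rightarrow> ('a \<Rightarrow> nat) \<Rightarrow> bool" where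
  "equitable G t f \<longleftrightarrow> (\<forall>i\<in>{1..t}. \<forall>j\<in>{1..t}.
     \<bar>int (card (color_class G f i)) - int (card (color_class G f j))\<bar> \<le> 1)"

text \<open>
  The strongly connected components of a symmetric digraph, \<^const>\<open>pre_digraph.sccs\<close>, are the
  connected components of the undirected graph.
\<close>

definition tree_coloring ::
  "('a, 'b) pre_digraph \<Rightarrow> nat \<Rightarrow> nat \<Rightarrow> nat \<Rightarrow> ('a \<Rightarrow> nat) \<Rightarrow> bool" where
  "tree_coloring G t k d f \<longleftrightarrow> coloring G t f \<and>
     (\<forall>i\<in>{1..t}. \<forall>H\<in>pre_digraph.sccs (G \<restriction> color_class G f i).
        undirected_tree H \<and> max_degree H \<le> k \<and> diameter H \<le> ereal (real d))"

end

theory Submission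
  imports Defs
begin

text \<open>
  Color the two parts of \<open>K\<^bsub>n,n\<^esub>\<close> with disjoint palettes, using on the \<open>i\<close>-th part \<open>x\<^sub>i\<close> colors
  \<open>a\<close> times each and \<open>y\<^sub>i\<close> colors \<open>a + 1\<close> times each. Every color class is then independent,
  so the components it induces are single vertices.
\<close>

lemma ex_map_with_card_fibres:
  assumes "finite I" "finite S" "card S = (\<Sum>i\<in>I. s i)"
  shows "\<exists>f. f ` S \<subseteq> I \<and> (\<forall>i\<in>I. card {v \<in> S. f v = i} = s i)"
proof -
  let ?T = "SIGMA i:I. {..<s i}"
  obtain b where b: "bij_betw b S ?T"
    using assms finite_same_card_bij[of S ?T] by auto
  have image: "b ` S = ?T"
    using b by (rule bij_betw_imp_surj_on)
  have "card {v \<in> S. fst (b v) = i} = s i" if "i \<in> I" for i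
  proof -
    have "b ` {v \<in> S. fst (b v) = i} = {t \<in> ?T. fst t = i}"
      unfolding image[symmetric] by auto
    also have "\<dots> = {i} \<times> {..<s i}"
      using that by auto
    finally have "bij_betw b {v \<in> S. fst (b v) = i} ({i} \<times> {..<s i})"
      by (intro bij_betw_subset[OF b]) auto
    then show ?thesis
      by (auto dest: bij_betw_same_card)
  qed
  moreover have "(fst \<circ> b) ` S \<subseteq> I"
    unfolding image_comp[symmetric] image by auto
  ultimately show ?thesis
    by (intro exI[of _ "fst \<circ> b"]) simp
qed

lemma ex_map_with_near_equal_fibres:
  assumes "finite I" "finite S" "card I = x + y" "card S = a * x + (a + 1) * y"
  shows "\<exists>f. f ` S \<subseteq> I \<and> (\<forall>i\<in>I. card {v \<in> S. f v = i} \<in> {a, a + 1})"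
proof -
  obtain J where J: "J \<subseteq> I" "card J = x"
    using assms(3) obtain_subset_with_card_n[of x I] by auto
  let ?s = "\<lambda>i. if i \<in> J then a else a + 1"
  have "card (I - J) = y"
    using J assms(1,3) by (simp add: card_Diff_subset finite_subset)
  then have "card S = (\<Sum>i\<in>I. ?s i)"
    using J assms(1,4) by (simp add: sum.If_cases Int_absorb1 Diff_eq[symmetric])
  from ex_map_with_card_fibres[OF assms(1,2) this] show ?thesis
    by (auto split: if_splits)
qed

lemma ex_refinement_with_near_equal_fibres:
  fixes p :: "'a \<Rightarrow> 'j" and q :: "'i \<Rightarrow> 'j"
  assumes "finite I" "finite S"
    and "\<And>j. \<exists>x y. card {i \<in> I. q i = j} = x + y \<and> card {v \<in> S. p v = j} = a * x + (a + 1) * y"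
  shows "\<exists>f. f ` S \<subseteq> I \<and> (\<forall>v\<in>S. q (f v) = p v) \<and> (\<forall>i\<in>I. card {v \<in> S. f v = i} \<in> {a, a + 1})"
proof -
  let ?S = "\<lambda>j. {v \<in> S. p v = j}" and ?I = "\<lambda>j. {i \<in> I. q i = j}"
  have "\<forall>j. \<exists>g. g ` ?S j \<subseteq> ?I j \<and> (\<forall>i\<in>?I j. card {v \<in> ?S j. g v = i} \<in> {a, a + 1})"
  proof
    fix j
    obtain x y where "card (?I j) = x + y" "card (?S j) = a * x + (a + 1) * y"
      using assms(3) by blast
    then show "\<exists>g. g ` ?S j \<subseteq> ?I j \<and> (\<forall>i\<in>?I j. card {v \<in> ?S j. g v = i} \<in> {a, a + 1})"
      using assms(1,2) by (intro ex_map_with_near_equal_fibres) simp_all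
  qed
  then obtain g where
    g: "\<And>j. g j ` ?S j \<subseteq> ?I j" "\<And>j i. i \<in> ?I j \<Longrightarrow> card {v \<in> ?S j. g j v = i} \<in> {a, a + 1}"
    unfolding choice_iff by blast
  define f where "f v = g (p v) v" for v
  have f: "f v \<in> I \<and> q (f v) = p v" if "v \<in> S" for v
    using g(1)[of "p v"] that by (auto simp: f_def)
  have "card {v \<in> S. f v = i} \<in> {a, a + 1}" if "i \<in> I" for i
  proof -
    have "{v \<in> S. f v = i} = {v \<in> ?S (q i). g (q i) v = i}"
      using f by (auto simp: f_def)
    then show ?thesis
      using g(2)[of i "q i"] that by simp
  qed
  then show ?thesis
    using f by blast
qed

lemma (in wf_digraph) strongly_connected_imp_connected:
  assumes "strongly_connected G"
  shows "connected G"
  using assms unfolding connected_def strongly_connected_def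
  by (auto intro: reachable_mk_symmetricI)

lemma (in wf_digraph)
  assumes "strongly_connected G" "arcs G = {}"
  shows arcless_strongly_connected_imp_undirected_tree: "undirected_tree G"
    and arcless_strongly_connected_imp_max_degree_eq_0: "max_degree G = 0"
    and arcless_strongly_connected_imp_diameter_eq_0: "diameter G = 0"
proof -
  have "connected G"
    using assms(1) by (rule strongly_connected_imp_connected)
  moreover have "undirected_forest G"
    using assms(2) by (auto simp: undirected_forest_def cycle_def awalk_def)
  ultimately show "undirected_tree G"
    by (simp add: undirected_tree_def)
  obtain v where v: "verts G = {v}"
    using connected_arcs_empty[OF \<open>connected G\<close> assms(2)] assms(1)
    by (auto simp: strongly_connected_def)
  then show "max_degree G = 0"
    using assms(2) by (simp add: max_degree_def out_degree_def out_arcs_def)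
  have "{p. awalk v p v} = {[]}"
    using v assms(2) by (auto simp: awalk_def)
  then show "diameter G = 0"
    using v by (simp add: diameter_def \<mu>_def zero_ereal_def)
qed

definition proper_coloring :: "('a, 'b) pre_digraph \<Rightarrow> ('a \<Rightarrow> 'c) \<Rightarrow> bool" where
  "proper_coloring G f \<longleftrightarrow> (\<forall>e\<in>arcs G. f (tail G e) \<noteq> f (head G e))"

lemma (in wf_digraph) proper_coloring_refinement:
  assumes "proper_coloring G p" "\<forall>v\<in>verts G. q (f v) = p v"
  shows "proper_coloring G f"
  using assms by (metis proper_coloring_def tail_in_verts head_in_verts)

lemma tree_coloring_if_proper_coloring:
  assumes "coloring G t f" "proper_coloring G f"
  shows "tree_coloring G t k d f"
  unfolding tree_coloring_def
proof (intro conjI ballI)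
  fix i H
  assume "H \<in> pre_digraph.sccs (G \<restriction> color_class G f i)"
  then have H: "induced_subgraph H (G \<restriction> color_class G f i)" "strongly_connected H"
    by (auto simp: pre_digraph.sccs_def)
  have "arcs (G \<restriction> color_class G f i) = {}"
    using assms(2) by (auto simp: proper_coloring_def color_class_def)
  then have "wf_digraph H" "arcs H = {}"
    using H(1) by (auto simp: induced_subgraph_def subgraph_def)
  then interpret H: wf_digraph H
    by simp
  show "undirected_tree H" "max_degree H \<le> k" "diameter H \<le> ereal (real d)"
    using H.arcless_strongly_connected_imp_undirected_tree[OF H(2)]
      H.arcless_strongly_connected_imp_max_degree_eq_0[OF H(2)]
      H.arcless_strongly_connected_imp_diameter_eq_0[OF H(2)] \<open>arcs H = {}\<close>
    by simp_all
qed fact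

lemma equitable_if_near_equal:
  assumes "\<forall>i\<in>{1..t}. card (color_class G f i) \<in> {a, a + 1}"
  shows "equitable G t f"
  unfolding equitable_def
proof (intro ballI)
  fix i j
  assume "i \<in> {1..t}" "j \<in> {1..t}"
  from this[THEN assms[rule_format]]
  show "\<bar>int (card (color_class G f i)) - int (card (color_class G f j))\<bar> \<le> 1"
    by auto
qed

lemma (in fin_digraph) ex_near_equal_tree_coloring:
  fixes p :: "'a \<Rightarrow> 'j" and q :: "nat \<Rightarrow> 'j"
  assumes "proper_coloring G p"
    and "\<And>j. \<exists>x y. card {i \<in> {1..t}. q i = j} = x + y \<and>
      card {v \<in> verts G. p v = j} = a * x + (a + 1) * y"
  shows "\<exists>f. tree_coloring G t k d f \<and> equitable G t f \<and>
    (\<forall>i\<in>{1..t}. card (color_class G f i) \<in> {a, a + 1})"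
proof -
  obtain f where "f ` verts G \<subseteq> {1..t}" and refines: "\<forall>v\<in>verts G. q (f v) = p v"
    and sizes: "\<forall>i\<in>{1..t}. card (color_class G f i) \<in> {a, a + 1}"
    using ex_refinement_with_near_equal_fibres[OF finite_atLeastAtMost finite_verts assms(2)]
    unfolding color_class_def by blast
  then have "tree_coloring G t k d f"
    using proper_coloring_refinement[of p q f] assms(1) refines
    by (intro tree_coloring_if_proper_coloring) (simp_all add: coloring_def)
  then show ?thesis
    using sizes equitable_if_near_equal by blast
qed

lemma (in fin_digraph) ex_near_equal_tree_coloring_of_2_coloring:
  fixes p :: "'a \<Rightarrow> bool"
  assumes "proper_coloring G p"
    and "card {v \<in> verts G. p v} = a * x1 + (a + 1) * y1"
    and "card {v \<in> verts G. \<not> p v} = a * x2 + (a + 1) * y2"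
  shows "\<exists>f. tree_coloring G (x1 + y1 + (x2 + y2)) k d f \<and>
    equitable G (x1 + y1 + (x2 + y2)) f \<and>
    (\<forall>i\<in>{1..x1 + y1 + (x2 + y2)}. card (color_class G f i) \<in> {a, a + 1})"
proof -
  let ?t = "x1 + y1 + (x2 + y2)" and ?q = "\<lambda>i. i \<le> x1 + y1"
  have "{i \<in> {1..?t}. ?q i} = {1..x1 + y1}" "{i \<in> {1..?t}. \<not> ?q i} = {x1 + y1 + 1..?t}"
    by auto
  then have palettes: "card {i \<in> {1..?t}. ?q i} = x1 + y1" "card {i \<in> {1..?t}. \<not> ?q i} = x2 + y2"
    by simp_all
  have "\<exists>x y. card {i \<in> {1..?t}. ?q i = j} = x + y \<and>
      card {v \<in> verts G. p v = j} = a * x + (a + 1) * y" for j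
  proof (cases j)
    case True
    then show ?thesis
      using assms(2) palettes(1) by (intro exI[of _ x1] exI[of _ y1]) simp
  next
    case False
    then show ?thesis
      using assms(3) palettes(2) by (intro exI[of _ x2] exI[of _ y2]) simp
  qed
  from ex_near_equal_tree_coloring[OF assms(1) this] show ?thesis .
qed

lemma complete_bipartite_digraph_proper_2_coloring:
  assumes "complete_bipartite_digraph m n G"
  obtains p :: "'a \<Rightarrow> bool" where "proper_coloring G p"
    "card {v \<in> verts G. p v} = m" "card {v \<in> verts G. \<not> p v} = n"
proof -
  obtain U V where UV: "verts G = U \<union> V" "U \<inter> V = {}" "card U = m" "card V = n"
      "arcs_ends G = U \<times> V \<union> V \<times> U"
    using assms unfolding complete_bipartite_digraph_def by blast
  have "proper_coloring G (\<lambda>v. v \<in> U)"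
    unfolding proper_coloring_def
  proof
    fix e
    assume "e \<in> arcs G"
    then have "(tail G e, head G e) \<in> U \<times> V \<union> V \<times> U"
      using UV(5) by (auto simp: arcs_ends_conv)
    then show "(tail G e \<in> U) \<noteq> (head G e \<in> U)"
      using UV(2) by blast
  qed
  moreover have "{v \<in> verts G. v \<in> U} = U" "{v \<in> verts G. v \<notin> U} = V"
    using UV(1,2) by auto
  ultimately show thesis
    using that UV(3,4) by simp
qed

lemma near_equal_part_size_nonneg:
  fixes a :: int
  assumes "a * int x + (a + 1) * int y > 0"
  shows "a \<ge> 0"
proof (rule ccontr)
  assume "\<not> a \<ge> 0"
  then have "a * int x \<le> 0" "(a + 1) * int y \<le> 0"
    by (auto intro: mult_nonpos_nonneg)
  then show False
    using assms by linarith
qed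

theorem theorem4p1:
  fixes G :: "('a, 'b) pre_digraph"
    and n k d x1 y1 x2 y2 z1 z2 :: nat
    and a :: int
  assumes "n \<ge> 1" and "k \<ge> 1" and "d \<ge> 1"
    and "complete_bipartite_digraph n n G"
    and "a * int x1 + (a + 1) * int y1 = int n"
    and "a * int x2 + (a + 1) * int y2 = int n"
    and "z1 = x1 + y1" and "z2 = x2 + y2"
  shows "\<exists>f. tree_coloring G (z1 + z2) k d f \<and> equitable G (z1 + z2) f \<and>
    (\<forall>i\<in>{1..z1 + z2}. int (card (color_class G f i)) = a \<or>
                       int (card (color_class G f i)) = a + 1)"
proof -
  interpret graph G
    using assms(4) by (simp add: complete_bipartite_digraph_def)
  have "a \<ge> 0"
    using near_equal_part_size_nonneg[of a x1 y1] assms(1,5) by simp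
  then obtain b where b: "a = int b"
    by (rule nonneg_int_cases)
  have solutions: "n = b * x1 + (b + 1) * y1" "n = b * x2 + (b + 1) * y2"
    using assms(5,6) unfolding b
    by (simp_all flip: of_nat_eq_iff[where 'a = int] add: algebra_simps)
  obtain p where p: "proper_coloring G p"
      "card {v \<in> verts G. p v} = b * x1 + (b + 1) * y1"
      "card {v \<in> verts G. \<not> p v} = b * x2 + (b + 1) * y2"
    using complete_bipartite_digraph_proper_2_coloring[OF assms(4)] solutions by metis
  from ex_near_equal_tree_coloring_of_2_coloring[OF p, of k d] show ?thesis
    unfolding assms(7,8) b by force
qed

end
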